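(* Let $d,m,N\ge 1$ be integers, let $\boldsymbol{L}=(\boldsymbol{L}(t))_{t\in\mathbb{R}}$ be a two-sided $\mathbb{R}^m$-valued Lévy process with $\mathbb{E}\boldsymbol{L}(1)=0$ and $\mathbb{E}\|\boldsymbol{L}(1)\|^2<\infty$, and let $A\in M_N(\mathbb{R})$, $B\in M_{N,m}(\mathbb{R})$, $C\in M_{d,N}(\mathbb{R})$, where all eigenvalues of $A$ have strictly negative real parts. Let $\boldsymbol{Y}$ be the output process of the linear state space model $$\mathrm{d}\boldsymbol{X}(t)=A\boldsymbol{X}(t)\,\mathrm{d}t+B\,\mathrm{d}\boldsymbol{L}(t),\qquad \boldsymbol{Y}(t)=C\boldsymbol{X}(t),\qquad t\in\mathbb{R}.$$ Then there exist $p\in\mathbb{N}$, $p\geq 1$, and matrices $\mathcal{A}\in M_{pd}(\mathbb{R})$, $\mathcal{B}\in M_{pd,m}(\mathbb{R})$, $\mathcal{C}\in M_{d,pd}(\mathbb{R})$ of MCARMA form (observer canonical form) such that $\boldsymbol{Y}$ is the output process of the linear state space model $$\mathrm{d}\boldsymbol{G}(t)=\mathcal{A}\boldsymbol{G}(t)\,\mathrm{d}t+\mathcal{B}\,\mathrm{d}\boldsymbol{L}(t),\qquad \boldsymbol{Y}(t)=\mathcal{C}\boldsymbol{G}(t),\qquad t\in\mathbb{R},$$ driven by the same Lévy process $\boldsymbol{L}$.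
   Context: $M_{k,l}(\mathbb{R})$ denotes the real $k\times l$ matrices, $M_k(\mathbb{R})=M_{k,k}(\mathbb{R})$, $\mathbb{I}_k$ is the $k\times k$ identity matrix and $0_k$ the $k\times k$ zero matrix. Output process: for a linear state space model $(A,B,C,\boldsymbol{L})$ whose state matrix $A$ has only eigenvalues with strictly negative real parts, the state equation $\mathrm{d}\boldsymbol{X}(t)=A\boldsymbol{X}(t)\,\mathrm{d}t+B\,\mathrm{d}\boldsymbol{L}(t)$ has a unique strictly stationary causal solution $\boldsymbol{X}(t)=\int_{-\infty}^t e^{A(t-u)}B\,\mathrm{d}\boldsymbol{L}(u)$. The output process of the model is $$\boldsymbol{Y}(t)=C\boldsymbol{X}(t)=\int_{-\infty}^t Ce^{A(t-u)}B\,\mathrm{d}\boldsymbol{L}(u),\qquad t\in\mathbb{R}.$$ Saying that $\boldsymbol{Y}$ is the output process of a model includes that the state matrix of that model has only eigenvalues with strictly negative real parts. MCARMA form (observer canonical form): matrices $\mathcal{A},\mathcal{B},\mathcal{C}$ are of MCARMA form with parameter $p$ if there are an integer $q$ with $0\le q<p$ and matrices $A_1,\ldots,A_p\in M_d(\mathbb{R})$, $B_0,\ldots,B_q\in M_{d,m}(\mathbb{R})$ such that $$\mathcal{A}=\begin{pmatrix}0&\mathbb{I}_d&0&\cdots&0\\0&0&\mathbb{I}_d&\ddots&\vdots\\\vdots&&\ddots&\ddots&0\\0&\cdots&\cdots&0&\mathbb{I}_d\\-A_p&-A_{p-1}&\cdots&\cdots&-A_1\end{pmatrix}\in M_{pd}(\mathbb{R}),$$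 $$\mathcal{B}=\begin{pmatrix}\beta_1^T&\cdots&\beta_p^T\end{pmatrix}^T\in M_{pd,m}(\mathbb{R}),\qquad \mathcal{C}=\begin{pmatrix}\mathbb{I}_d&0_d&\cdots&0_d\end{pmatrix}\in M_{d,pd}(\mathbb{R}),$$ where the blocks $\beta_1,\ldots,\beta_p\in M_{d,m}(\mathbb{R})$ are given recursively, for $j=p-1,p-2,\ldots,0$, by $$\beta_{p-j}=I_{\{0,\ldots,q\}}(j)\Bigl[-\sum_{i=1}^{p-j-1}A_i\beta_{p-j-i}+B_{q-j}\Bigr],$$ with $I_{\{0,\ldots,q\}}$ the indicator function of $\{0,\ldots,q\}$ (so $\beta_{p-j}=0$ for $j>q$). *)

theory Defs
  imports "HOL-Probability.Probability" "Jordan_Normal_Form.Char_Poly"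
begin

unbundle no vec_syntax
unbundle no inner_syntax
hide_type (open) Finite_Cartesian_Product.vec
hide_const (open) Finite_Cartesian_Product.vec Finite_Cartesian_Product.mat

text \<open>The dimension of the MCARMA representation is existentially quantified, so vectors and
  matrices are the carrier-based ones: the space of real \<open>k\<close>-vectors is \<open>carrier_vec k\<close>.\<close>

definition eucl_norm :: "real vec \<Rightarrow> real" where
  "eucl_norm v = sqrt (v \<bullet> v)"

definition frobenius_norm :: "real mat \<Rightarrow> real" where
  "frobenius_norm F = sqrt (\<Sum>i<dim_row F. \<Sum>j<dim_col F. (F $$ (i, j))\<^sup>2)"

text \<open>The Borel space of real \<open>k\<close>-vectors, transported from the \<open>k\<close>-fold product of \<open>borel\<close>
  along the coordinates. Only its space and its measurable sets matter.\<close>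

definition vec_borel :: "nat \<Rightarrow> real vec measure" where
  "vec_borel k = vimage_algebra (carrier_vec k) (\<lambda>v. \<lambda>i\<in>{..<k}. v $ i) (\<Pi>\<^sub>M i\<in>{..<k}. borel)"

text \<open>Entrywise sum; a separate constant because matrices of all sizes share one type, so
  \<open>sum\<close> is not available on them.\<close>

definition mat_sum :: "nat \<Rightarrow> nat \<Rightarrow> ('i \<Rightarrow> real mat) \<Rightarrow> 'i set \<Rightarrow> real mat" where
  "mat_sum k l F I = mat k l (\<lambda>(i, j). \<Sum>x\<in>I. F x $$ (i, j))"

definition mat_exp :: "real mat \<Rightarrow> real mat" where
  "mat_exp A = mat (dim_row A) (dim_row A) (\<lambda>(i, j). \<Sum>n. (A ^\<^sub>m n) $$ (i, j) / fact n)"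

definition stable_mat :: "real mat \<Rightarrow> bool" where
  "stable_mat A \<longleftrightarrow> (\<forall>z. eigenvalue (map_mat complex_of_real A) z \<longrightarrow> Re z < 0)"

definition two_sided_levy :: "'w measure \<Rightarrow> nat \<Rightarrow> (real \<Rightarrow> 'w \<Rightarrow> real vec) \<Rightarrow> bool" where
  "two_sided_levy M m L \<longleftrightarrow>
     prob_space M \<and>
     (\<forall>t. L t \<in> measurable M (vec_borel m)) \<and>
     (AE \<omega> in M. L 0 \<omega> = 0\<^sub>v m) \<and>
     \<comment> \<open>independent increments\<close>
     (\<forall>n. \<forall>t :: nat \<Rightarrow> real. (\<forall>k<n. t k \<le> t (Suc k)) \<longrightarrow>
        prob_space.indep_vars M (\<lambda>_. vec_borel m) (\<lambda>k \<omega>. L (t (Suc k)) \<omega> - L (t k) \<omega>) {..<n}) \<and>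
     \<comment> \<open>stationary increments\<close>
     (\<forall>s t h. s \<le> t \<longrightarrow>
        distr M (vec_borel m) (\<lambda>\<omega>. L (t + h) \<omega> - L (s + h) \<omega>) =
        distr M (vec_borel m) (\<lambda>\<omega>. L t \<omega> - L s \<omega>)) \<and>
     \<comment> \<open>continuity in probability\<close>
     (\<forall>s. \<forall>\<epsilon>>0.
        ((\<lambda>t. measure M {\<omega> \<in> space M. \<epsilon> < eucl_norm (L t \<omega> - L s \<omega>)}) \<longlongrightarrow> 0) (at s)) \<and>
     \<comment> \<open>right-continuous paths with left limits\<close>
     (AE \<omega> in M. \<forall>t. \<forall>i<m.
        ((\<lambda>s. L s \<omega> $ i) \<longlongrightarrow> L t \<omega> $ i) (at_right t) \<and>
        (\<exists>l. ((\<lambda>s. L s \<omega> $ i) \<longlongrightarrow> l) (at_left t)))"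

text \<open>Integral of a deterministic matrix-valued function against \<open>L\<close> (for centred \<open>L\<close> with
  finite second moments): the \<open>L\<^sup>2\<close>-limit of the integrals of step functions that approximate
  the integrand in \<open>L\<^sup>2\<close> of the Lebesgue measure. A list of triples \<open>(a, b, F)\<close> encodes
  the step function that is the sum of \<open>F\<close> times the indicator of \<open>{a<..b}\<close>.\<close>

type_synonym step = "(real \<times> real \<times> real mat) list"

definition valid_step :: "nat \<Rightarrow> nat \<Rightarrow> step \<Rightarrow> bool" where
  "valid_step k m S \<longleftrightarrow> (\<forall>(a, b, F) \<in> set S. a \<le> b \<and> F \<in> carrier_mat k m)"

definition step_fun :: "nat \<Rightarrow> nat \<Rightarrow> step \<Rightarrow> real \<Rightarrow> real mat" where
  "step_fun k m S u = mat k m (\<lambda>(i, j). \<Sum>(a, b, F)\<leftarrow>S. indicator {a<..b} u * F $$ (i, j))"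

definition step_integral ::
    "(real \<Rightarrow> 'w \<Rightarrow> real vec) \<Rightarrow> nat \<Rightarrow> step \<Rightarrow> 'w \<Rightarrow> real vec" where
  "step_integral L k S \<omega> = vec k (\<lambda>i. \<Sum>(a, b, F)\<leftarrow>S. (F *\<^sub>v (L b \<omega> - L a \<omega>)) $ i)"

definition has_levy_integral ::
    "'w measure \<Rightarrow> (real \<Rightarrow> 'w \<Rightarrow> real vec) \<Rightarrow> nat \<Rightarrow> nat \<Rightarrow> (real \<Rightarrow> real mat) \<Rightarrow>
     ('w \<Rightarrow> real vec) \<Rightarrow> bool" where
  "has_levy_integral M L k m f Z \<longleftrightarrow>
     (\<forall>u. f u \<in> carrier_mat k m) \<and>
     (\<forall>i<k. \<forall>j<m. (\<lambda>u. f u $$ (i, j)) \<in> borel_measurable lborel) \<and>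
     Z \<in> measurable M (vec_borel k) \<and>
     (\<exists>S. (\<forall>n. valid_step k m (S n)) \<and>
        (\<lambda>n. \<integral>\<^sup>+ u. ennreal ((frobenius_norm (f u - step_fun k m (S n) u))\<^sup>2) \<partial>lborel)
          \<longlonglongrightarrow> 0 \<and>
        (\<lambda>n. \<integral>\<^sup>+ \<omega>. ennreal ((eucl_norm (Z \<omega> - step_integral L k (S n) \<omega>))\<^sup>2) \<partial>M)
          \<longlonglongrightarrow> 0)"

definition strictly_stationary :: "'w measure \<Rightarrow> nat \<Rightarrow> (real \<Rightarrow> 'w \<Rightarrow> real vec) \<Rightarrow> bool" where
  "strictly_stationary M k X \<longleftrightarrow>
     (\<forall>t. X t \<in> measurable M (vec_borel k)) \<and>
     (\<forall>J h. finite J \<longrightarrow>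
        distr M (\<Pi>\<^sub>M t\<in>J. vec_borel k) (\<lambda>\<omega>. \<lambda>t\<in>J. X (t + h) \<omega>) =
        distr M (\<Pi>\<^sub>M t\<in>J. vec_borel k) (\<lambda>\<omega>. \<lambda>t\<in>J. X t \<omega>))"

text \<open>The past of \<open>L\<close> up to time \<open>t\<close> is generated by increments: for \<open>t < 0\<close> the variable
  \<open>L t\<close> itself, normalised by \<open>L 0 = 0\<close>, depends on the increments after \<open>t\<close>.\<close>

definition past :: "'w measure \<Rightarrow> nat \<Rightarrow> (real \<Rightarrow> 'w \<Rightarrow> real vec) \<Rightarrow> real \<Rightarrow> 'w measure" where
  "past M m L t = sigma (space M)
     {(\<lambda>\<omega>. L v \<omega> - L u \<omega>) -` S \<inter> space M | u v S. u \<le> v \<and> v \<le> t \<and> S \<in> sets (vec_borel m)}"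

definition causal ::
    "'w measure \<Rightarrow> nat \<Rightarrow> nat \<Rightarrow> (real \<Rightarrow> 'w \<Rightarrow> real vec) \<Rightarrow> (real \<Rightarrow> 'w \<Rightarrow> real vec) \<Rightarrow> bool" where
  "causal M m k L X \<longleftrightarrow>
     (\<forall>t. \<exists>Z \<in> measurable (past M m L t) (vec_borel k). AE \<omega> in M. X t \<omega> = Z \<omega>)"

text \<open>The state equation \<open>dX(t) = A X(t) dt + B dL(t)\<close> in integrated form.\<close>

definition solves_state_equation ::
    "'w measure \<Rightarrow> (real \<Rightarrow> 'w \<Rightarrow> real vec) \<Rightarrow> nat \<Rightarrow> real mat \<Rightarrow> real mat \<Rightarrow>
     (real \<Rightarrow> 'w \<Rightarrow> real vec) \<Rightarrow> bool" where
  "solves_state_equation M L k A B X \<longleftrightarrow>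
     (AE \<omega> in M. \<forall>s t. s \<le> t \<longrightarrow>
        (\<forall>i<k. set_integrable lborel {s..t} (\<lambda>u. X u \<omega> $ i)) \<and>
        X t \<omega> - X s \<omega> =
          vec k (\<lambda>i. LINT u:{s..t}|lborel. (A *\<^sub>v X u \<omega>) $ i) + B *\<^sub>v (L t \<omega> - L s \<omega>))"

text \<open>The unique strictly stationary causal solution of the state equation, together with its
  moving average representation.\<close>

definition state_process ::
    "'w measure \<Rightarrow> (real \<Rightarrow> 'w \<Rightarrow> real vec) \<Rightarrow> nat \<Rightarrow> nat \<Rightarrow> real mat \<Rightarrow> real mat \<Rightarrow>
     (real \<Rightarrow> 'w \<Rightarrow> real vec) \<Rightarrow> bool" where
  "state_process M L k m A B X \<longleftrightarrow>
     solves_state_equation M L k A B X \<and>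
     strictly_stationary M k X \<and>
     causal M m k L X \<and>
     (\<forall>t. has_levy_integral M L k m (\<lambda>u. if u \<le> t then mat_exp ((t - u) \<cdot>\<^sub>m A) * B else 0\<^sub>m k m) (X t))"

text \<open>\<open>Y\<close> is determined up to modification, as stochastic integrals are only defined almost
  surely for each \<open>t\<close>.\<close>

definition output_process ::
    "'w measure \<Rightarrow> (real \<Rightarrow> 'w \<Rightarrow> real vec) \<Rightarrow> nat \<Rightarrow> nat \<Rightarrow> nat \<Rightarrow> real mat \<Rightarrow> real mat \<Rightarrow>
     real mat \<Rightarrow> (real \<Rightarrow> 'w \<Rightarrow> real vec) \<Rightarrow> bool" where
  "output_process M L k m d A B C Y \<longleftrightarrow>
     A \<in> carrier_mat k k \<and> B \<in> carrier_mat k m \<and> C \<in> carrier_mat d k \<and>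
     stable_mat A \<and>
     (\<forall>t. Y t \<in> measurable M (vec_borel d)) \<and>
     (\<exists>X. state_process M L k m A B X \<and> (\<forall>t. AE \<omega> in M. Y t \<omega> = C *\<^sub>v X t \<omega>))"

text \<open>Block matrix with \<open>p \<times> r\<close> blocks of size \<open>k \<times> l\<close>; block indices start at 0.\<close>

definition block_mat :: "nat \<Rightarrow> nat \<Rightarrow> nat \<Rightarrow> nat \<Rightarrow> (nat \<Rightarrow> nat \<Rightarrow> real mat) \<Rightarrow> real mat" where
  "block_mat p r k l F =
     mat (p * k) (r * l) (\<lambda>(i, j). F (i div k) (j div l) $$ (i mod k, j mod l))"

text \<open>The recursion determines \<open>\<beta> 1, \<dots>, \<beta> p\<close>, so quantifying over \<open>\<beta>\<close> adds no freedom.\<close>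

definition mcarma_form ::
    "nat \<Rightarrow> nat \<Rightarrow> nat \<Rightarrow> real mat \<Rightarrow> real mat \<Rightarrow> real mat \<Rightarrow> bool" where
  "mcarma_form d m p \<A> \<B> \<C> \<longleftrightarrow>
     (\<exists>q<p. \<exists>A B \<beta> :: nat \<Rightarrow> real mat.
        (\<forall>i\<in>{1..p}. A i \<in> carrier_mat d d) \<and>
        (\<forall>i\<in>{0..q}. B i \<in> carrier_mat d m) \<and>
        (\<forall>j<p. \<beta> (p - j) =
           (if j \<in> {0..q}
            then - mat_sum d m (\<lambda>i. A i * \<beta> (p - j - i)) {1..p - j - 1} + B (q - j)
            else 0\<^sub>m d m)) \<and>
        \<A> = block_mat p p d d
               (\<lambda>r c. if r = p - 1 then - A (p - c) else if c = r + 1 then 1\<^sub>m d else 0\<^sub>m d d) \<and>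
        \<B> = block_mat p 1 d m (\<lambda>r c. \<beta> (r + 1)) \<and>
        \<C> = block_mat 1 p d d (\<lambda>r c. if c = 0 then 1\<^sub>m d else 0\<^sub>m d d))"

end

theory Submission
  imports Defs
begin

text \<open>The idea is to change the state variable, not the process. Let
  \<open>z\<^sup>N + a\<^sub>N\<^sub>-\<^sub>1 z\<^sup>N\<^sup>-\<^sup>1 + \<dots> + a\<^sub>0\<close> be the characteristic polynomial of \<open>A\<close> and let \<open>T\<close> be the
  observability matrix with block rows \<open>C, CA, \<dots>, CA\<^sup>N\<^sup>-\<^sup>1\<close>. By Cayley--Hamilton \<open>T A = \<A> T\<close>, where
  \<open>\<A>\<close> is the block companion matrix with the scalar blocks \<open>a\<^sub>c I\<^sub>d\<close>; its eigenvalues are roots of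
  the characteristic polynomial, so stability carries over. Since \<open>T\<close> intertwines the two flows,
  \<open>G = T X\<close> solves the state equation of \<open>(\<A>, T B)\<close> and has the required moving average
  representation, and the first block row of \<open>T\<close> gives \<open>C X = \<C> G\<close>. Finally any sequence of
  blocks \<open>\<beta>\<^sub>k\<close>, here \<open>C A\<^sup>k\<^sup>-\<^sup>1 B\<close>, arises from the recursion of the canonical form with \<open>q = p - 1\<close>,
  because the recursion can be solved for \<open>B\<^sub>0, \<dots>, B\<^sub>q\<close>.\<close>

subsection \<open>The Cayley--Hamilton theorem\<close>

text \<open>Comparing the coefficients of \<open>Q (x I - A) = \<chi> I\<close> for the adjugate \<open>Q\<close> and multiplying the
  \<open>k\<close>-th identity by \<open>A\<^sup>k\<close> from the right makes the sum telescope.\<close>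

lemma cayley_hamilton_entry:
  fixes A :: "'a :: comm_ring_1 mat"
  assumes A: "A \<in> carrier_mat n n" and i: "i < n" and t: "t < n"
  shows "(\<Sum>k\<le>n. coeff (char_poly A) k * (A ^\<^sub>m k) $$ (i, t)) = 0"
proof -
  define P where "P = char_poly_matrix A"
  define Q where "Q = adj_mat P"
  define \<chi> where "\<chi> = char_poly A"
  \<comment> \<open>With \<open>Q_k\<close> the matrix of the coefficients of \<open>x^k\<close> in
    \<open>Q\<close>, this is the entry \<open>(i, t)\<close> of \<open>Q_k A^(k+1)\<close>, the
    quantity that telescopes.\<close>
  define u where "u k = (\<Sum>l<n. coeff (Q $$ (i, l)) k * (A ^\<^sub>m Suc k) $$ (l, t))" for k
  have P: "P \<in> carrier_mat n n" using A by (simp add: P_def)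
  have Q: "Q \<in> carrier_mat n n" and QP: "Q * P = \<chi> \<cdot>\<^sub>m 1\<^sub>m n"
    using adj_mat[OF P] by (auto simp: Q_def \<chi>_def char_poly_def P_def)
  have P_entry: "P $$ (l, j) = (if l = j then [:0, 1:] else 0) + [:- (A $$ (l, j)):]"
    if "l < n" "j < n" for l j
    using A that by (simp add: P_def char_poly_matrix_def)
  \<comment> \<open>Entry \<open>(i, j)\<close> of \<open>Q_(k-1) - Q_k A = c_k I\<close>. The case
    \<open>k = 0\<close> is separate because \<open>k - 1\<close> truncates, while
    \<open>Q_(-1)\<close> has to read as zero.\<close>
  have coeff_eq: "(if k = 0 then 0 else coeff (Q $$ (i, j)) (k - 1)) -
      (\<Sum>l<n. coeff (Q $$ (i, l)) k * A $$ (l, j)) = (if i = j then coeff \<chi> k else 0)"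
    if j: "j < n" for j k
  proof -
    have "(if i = j then \<chi> else 0) = (Q * P) $$ (i, j)"
      using i j by (simp add: QP)
    also have "\<dots> = (\<Sum>l<n. Q $$ (i, l) * P $$ (l, j))"
      using P Q i j by (auto simp: scalar_prod_def atLeast0LessThan)
    also have "\<dots> = (\<Sum>l<n. (if l = j then pCons 0 (Q $$ (i, l)) else 0)
        - Polynomial.smult (A $$ (l, j)) (Q $$ (i, l)))"
      using j by (intro sum.cong) (auto simp: P_entry algebra_simps)
    also have "\<dots> = pCons 0 (Q $$ (i, j)) - (\<Sum>l<n. Polynomial.smult (A $$ (l, j)) (Q $$ (i, l)))"
      using j by (simp add: sum_subtractf)
    finally have "coeff (if i = j then \<chi> else 0) k =
      coeff (pCons 0 (Q $$ (i, j)) - (\<Sum>l<n. Polynomial.smult (A $$ (l, j)) (Q $$ (i, l)))) k"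
      by simp
    then show ?thesis
      by (cases k) (auto simp: coeff_sum coeff_pCons mult.commute split: if_splits)
  qed
  \<comment> \<open>Powers are defined with the new factor on the right; the telescoping needs it on
    the left.\<close>
  have pow_Suc_left: "(\<Sum>j<n. A $$ (l, j) * (A ^\<^sub>m k) $$ (j, t)) = (A ^\<^sub>m Suc k) $$ (l, t)"
    if l: "l < n" for l k
  proof -
    have "A ^\<^sub>m Suc k = A * A ^\<^sub>m k"
    proof (induction k)
      case (Suc k)
      then have "A ^\<^sub>m Suc (Suc k) = (A * A ^\<^sub>m k) * A" by simp
      also have "\<dots> = A * (A ^\<^sub>m k * A)"
        using A by (intro assoc_mult_mat) auto
      finally show ?case by simp
    qed (use A in auto)
    then show ?thesis
      using A l t pow_carrier_mat[OF A, of k] by (simp add: scalar_prod_def atLeast0LessThan)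
  qed
  have telescope: "coeff \<chi> k * (A ^\<^sub>m k) $$ (i, t) = (if k = 0 then 0 else u (k - 1)) - u k" for k
  proof -
    have "coeff \<chi> k * (A ^\<^sub>m k) $$ (i, t) =
        (\<Sum>j<n. (if i = j then coeff \<chi> k else 0) * (A ^\<^sub>m k) $$ (j, t))"
      using i by (simp add: if_distrib[of "\<lambda>x. x * _"] cong: if_cong)
    also have "\<dots> = (\<Sum>j<n. (if k = 0 then 0 else coeff (Q $$ (i, j)) (k - 1)) * (A ^\<^sub>m k) $$ (j, t))
        - (\<Sum>j<n. (\<Sum>l<n. coeff (Q $$ (i, l)) k * A $$ (l, j)) * (A ^\<^sub>m k) $$ (j, t))"
      by (simp add: coeff_eq[symmetric] left_diff_distrib sum_subtractf)
    also have "(\<Sum>j<n. (\<Sum>l<n. coeff (Q $$ (i, l)) k * A $$ (l, j)) * (A ^\<^sub>m k) $$ (j, t)) =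
        (\<Sum>l<n. coeff (Q $$ (i, l)) k * (\<Sum>j<n. A $$ (l, j) * (A ^\<^sub>m k) $$ (j, t)))"
      by (simp add: sum_distrib_left sum_distrib_right mult.assoc) (rule sum.swap)
    also have "\<dots> = u k"
      unfolding u_def by (intro sum.cong) (simp_all only: pow_Suc_left lessThan_iff)
    also have "(\<Sum>j<n. (if k = 0 then 0 else coeff (Q $$ (i, j)) (k - 1)) * (A ^\<^sub>m k) $$ (j, t)) =
        (if k = 0 then 0 else u (k - 1))"
      by (cases k) (simp_all add: u_def)
    finally show ?thesis .
  qed
  have partial_sum: "(\<Sum>k\<le>r. coeff \<chi> k * (A ^\<^sub>m k) $$ (i, t)) = - u r" for r
    by (induction r) (simp_all add: telescope del: pow_mat.simps)
  \<comment> \<open>Large enough in two ways: beyond the degree of every entry in row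
    \<open>i\<close> of \<open>Q\<close>, so \<open>u r\<close> vanishes, and beyond
    \<open>n\<close>, so the additional coefficients of \<chi> vanish.\<close>
  define r where "r = Suc (n + (\<Sum>l<n. degree (Q $$ (i, l))))"
  have "degree (Q $$ (i, l)) < r" if "l < n" for l
    using member_le_sum[of l "{..<n}" "\<lambda>l. degree (Q $$ (i, l))"] that by (simp add: r_def)
  then have "u r = 0"
    by (simp add: u_def coeff_eq_0 del: pow_mat.simps)
  moreover have "(\<Sum>k\<le>n. coeff \<chi> k * (A ^\<^sub>m k) $$ (i, t)) = (\<Sum>k\<le>r. coeff \<chi> k * (A ^\<^sub>m k) $$ (i, t))"
    using degree_monic_char_poly[OF A]
    by (intro sum.mono_neutral_left) (auto simp: r_def \<chi>_def coeff_eq_0)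
  ultimately show ?thesis
    using partial_sum[of r] by (simp add: \<chi>_def)
qed

subsection \<open>Block matrices\<close>

lemma sum_blocks:
  fixes f :: "nat \<Rightarrow> 'a :: comm_monoid_add"
  shows "(\<Sum>l<q * d. f l) = (\<Sum>c<q. \<Sum>e<d. f (c * d + e))"
proof -
  have "sum f {c * d..<c * d + d} = (\<Sum>e<d. f (c * d + e))" for c
    using sum.shift_bounds_nat_ivl[of f 0 "c * d" d]
    by (simp add: atLeast0LessThan add.commute)
  then show ?thesis
    using sum.nat_group[of f d q] by simp
qed

lemma block_mat_carrier: "block_mat p q k l F \<in> carrier_mat (p * k) (q * l)"
  by (simp add: block_mat_def)

lemma block_index:
  assumes "i < p * k"
  shows "i div k < p" "i mod k < (k::nat)"
  using assms by (auto simp: less_mult_imp_div_less) (metis gr0I mod_less_divisor mult_0_right not_less_zero)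

text \<open>Splitting the inner index into a block number and an offset turns the scalar product
  into a double sum; the sums over the offset are entries of the block products.\<close>

lemma block_mat_mult:
  assumes "\<And>i x. i < p \<Longrightarrow> x < q \<Longrightarrow> F i x \<in> carrier_mat k l"
    and "\<And>x j. x < q \<Longrightarrow> j < r \<Longrightarrow> G x j \<in> carrier_mat l n"
  shows "block_mat p q k l F * block_mat q r l n G =
    block_mat p r k n (\<lambda>i j. mat_sum k n (\<lambda>x. F i x * G x j) {..<q})"
proof (rule eq_matI, goal_cases)
  case (1 i j)
  then have i: "i < p * k" and j: "j < r * n" by (auto simp: block_mat_def)
  note idx = block_index[OF i] block_index[OF j]
  have "(block_mat p q k l F * block_mat q r l n G) $$ (i, j) =
      (\<Sum>y<q * l. F (i div k) (y div l) $$ (i mod k, y mod l) * G (y div l) (j div n) $$ (y mod l, j mod n))"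
    using i j by (auto simp: block_mat_def scalar_prod_def atLeast0LessThan)
  also have "\<dots> = (\<Sum>c<q. \<Sum>e<l. F (i div k) c $$ (i mod k, e) * G c (j div n) $$ (e, j mod n))"
    by (simp add: sum_blocks)
  also have "\<dots> = (\<Sum>c<q. (F (i div k) c * G c (j div n)) $$ (i mod k, j mod n))"
  proof (rule sum.cong)
    fix c assume c: "c \<in> {..<q}"
    then show "(\<Sum>e<l. F (i div k) c $$ (i mod k, e) * G c (j div n) $$ (e, j mod n)) =
      (F (i div k) c * G c (j div n)) $$ (i mod k, j mod n)"
      using assms(1)[of "i div k" c] assms(2)[of c "j div n"] idx
      by (auto simp: scalar_prod_def atLeast0LessThan)
  qed simp
  finally show ?case
    using i j idx by (simp add: block_mat_def mat_sum_def)
qed (auto simp: block_mat_def)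

lemma block_mat_cong:
  assumes "\<And>i j. i < p \<Longrightarrow> j < q \<Longrightarrow> F i j = G i j"
  shows "block_mat p q k l F = block_mat p q k l G"
proof (rule eq_matI, goal_cases)
  case (1 i j)
  then have "i < p * k" "j < q * l" by (auto simp: block_mat_def)
  then show ?case
    using assms[OF block_index(1) block_index(1)] by (simp add: block_mat_def)
qed (auto simp: block_mat_def)

lemma block_mat_single: "A \<in> carrier_mat k l \<Longrightarrow> block_mat 1 1 k l (\<lambda>_ _. A) = A"
  by (rule eq_matI) (auto simp: block_mat_def)

lemma mat_sum_single: "F x \<in> carrier_mat k l \<Longrightarrow> mat_sum k l F {x} = F x"
  by (rule eq_matI) (auto simp: mat_sum_def)

text \<open>Reading the right factor as a single block reduces this to \<open>block_mat_mult\<close>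
  with one summand per block.\<close>

lemma block_column_mult:
  assumes F: "\<And>i. i < p \<Longrightarrow> F i \<in> carrier_mat k l" and A: "A \<in> carrier_mat l n"
  shows "block_mat p 1 k l (\<lambda>i _. F i) * A = block_mat p 1 k n (\<lambda>i _. F i * A)"
proof -
  have "block_mat p 1 k l (\<lambda>i _. F i) * A = block_mat p 1 k l (\<lambda>i _. F i) * block_mat 1 1 l n (\<lambda>_ _. A)"
    by (simp only: block_mat_single[OF A])
  also have "\<dots> = block_mat p 1 k n (\<lambda>i _. mat_sum k n (\<lambda>_. F i * A) {..<1::nat})"
    using F A by (intro block_mat_mult)
  also have "\<dots> = block_mat p 1 k n (\<lambda>i _. F i * A)"
    using F A by (intro block_mat_cong) (auto simp: lessThan_Suc intro!: mat_sum_single mult_carrier_mat)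
  finally show ?thesis .
qed

subsection \<open>The matrix exponential\<close>

text \<open>Each multiplication by \<open>A\<close> costs at most a factor dominated by the sum of
  the absolute values of all its entries. Any geometric rate is good enough against the factorials
  of the exponential series.\<close>

lemma pow_mat_entry_bound:
  fixes A :: "real mat"
  assumes A: "A \<in> carrier_mat k k" and "i < k" "j < k"
  shows "\<bar>(A ^\<^sub>m n) $$ (i, j)\<bar> \<le> (1 + (\<Sum>r<k. \<Sum>c<k. \<bar>A $$ (r, c)\<bar>)) ^ n"
  using assms(2,3)
proof (induction n arbitrary: i j)
  case 0
  then show ?case using A by simp
next
  case (Suc n)
  define K where "K = 1 + (\<Sum>r<k. \<Sum>c<k. \<bar>A $$ (r, c)\<bar>)"
  have K: "K \<ge> 1" unfolding K_def by (simp add: sum_nonneg)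
  have "(A ^\<^sub>m Suc n) $$ (i, j) = (\<Sum>l<k. (A ^\<^sub>m n) $$ (i, l) * A $$ (l, j))"
    using Suc.prems A pow_carrier_mat[OF A, of n] by (simp add: scalar_prod_def atLeast0LessThan)
  also have "\<bar>\<dots>\<bar> \<le> (\<Sum>l<k. \<bar>(A ^\<^sub>m n) $$ (i, l)\<bar> * \<bar>A $$ (l, j)\<bar>)"
    by (simp flip: abs_mult)
  also have "\<dots> \<le> (\<Sum>l<k. K ^ n * (\<Sum>c<k. \<bar>A $$ (l, c)\<bar>))"
    using Suc K by (intro sum_mono mult_mono member_le_sum) (auto simp: K_def)
  also have "\<dots> \<le> K ^ n * K"
    using K by (simp add: K_def flip: sum_distrib_left)
  finally show ?case by (simp add: K_def mult.commute)
qed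

text \<open>Comparison with a scalar exponential series. Convergence is what permits exchanging the
  series with the finite sums of a matrix product.\<close>

lemma summable_mat_exp_entry:
  assumes A: "A \<in> carrier_mat k k" and "i < k" "j < k"
  shows "summable (\<lambda>n. (A ^\<^sub>m n) $$ (i, j) / fact n :: real)"
proof (rule summable_comparison_test')
  show "norm ((A ^\<^sub>m n) $$ (i, j) / fact n) \<le>
      inverse (fact n) * (1 + (\<Sum>r<k. \<Sum>c<k. \<bar>A $$ (r, c)\<bar>)) ^ n" if "n \<ge> 0" for n
    using pow_mat_entry_bound[OF assms, of n] by (simp add: divide_simps)
qed (rule summable_exp)

lemma mat_exp_carrier: "A \<in> carrier_mat k k \<Longrightarrow> mat_exp A \<in> carrier_mat k k"
  by (simp add: mat_exp_def)

lemma pow_mat_intertwine: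
  fixes A :: "'a :: comm_ring_1 mat"
  assumes A: "A \<in> carrier_mat k k" and A': "A' \<in> carrier_mat k' k'" and T: "T \<in> carrier_mat k' k"
    and TA: "T * A = A' * T"
  shows "T * A ^\<^sub>m n = A' ^\<^sub>m n * T"
proof (induction n)
  case (Suc n)
  have "T * A ^\<^sub>m Suc n = T * A ^\<^sub>m n * A"
    using A T by (simp add: assoc_mult_mat[of _ k' k _ k _ k])
  also have "\<dots> = A' ^\<^sub>m n * (T * A)"
    using A T A' by (simp add: Suc assoc_mult_mat[of _ k' k' _ k _ k])
  also have "\<dots> = A' ^\<^sub>m Suc n * T"
    using A T A' by (simp add: TA assoc_mult_mat[of _ k' k' _ k' _ k])
  finally show ?case .
qed (use assms in auto)

text \<open>The powers are intertwined term by term, and the finite sums of the two products commute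
  with the convergent entrywise series. Thus \<open>T\<close> maps the flow of \<open>A\<close> to
  the flow of \<open>A'\<close>.\<close>

lemma mat_exp_intertwine:
  assumes A: "A \<in> carrier_mat k k" and A': "A' \<in> carrier_mat k' k'" and T: "T \<in> carrier_mat k' k"
    and TA: "T * A = A' * T"
  shows "T * mat_exp A = mat_exp A' * T"
proof (rule eq_matI)
  fix i j assume "i < dim_row (mat_exp A' * T)" "j < dim_col (mat_exp A' * T)"
  then have i: "i < k'" and j: "j < k" using A' T by (auto simp: mat_exp_def)
  \<comment> \<open>The inner dimension \<open>c\<close> stays free because products are formed on
    both sides of \<open>T\<close>: \<open>c = k\<close> on the right of it and
    \<open>c = k'\<close> on the left.\<close>
  have entry: "(X * Y) $$ (i, j) = (\<Sum>l<c. X $$ (i, l) * Y $$ (l, j))"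
    if "X \<in> carrier_mat k' c" "Y \<in> carrier_mat c k" for X Y :: "real mat" and c
    using that i j by (auto simp: scalar_prod_def atLeast0LessThan)
  have "(T * mat_exp A) $$ (i, j) = (\<Sum>l<k. T $$ (i, l) * (\<Sum>n. (A ^\<^sub>m n) $$ (l, j) / fact n))"
    using A j by (simp add: entry[OF T mat_exp_carrier[OF A]]) (simp add: mat_exp_def)
  also have "\<dots> = (\<Sum>n. \<Sum>l<k. T $$ (i, l) * ((A ^\<^sub>m n) $$ (l, j) / fact n))"
    using summable_mat_exp_entry[OF A] j
    by (subst suminf_sum) (auto intro!: summable_mult sum.cong simp: suminf_mult simp del: times_divide_eq_right)
  also have "\<dots> = (\<Sum>n. (T * A ^\<^sub>m n) $$ (i, j) / fact n)"
    by (simp add: entry[OF T pow_carrier_mat[OF A]] sum_divide_distrib)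
  also have "\<dots> = (\<Sum>n. (A' ^\<^sub>m n * T) $$ (i, j) / fact n)"
    by (simp add: pow_mat_intertwine[OF assms])
  also have "\<dots> = (\<Sum>n. \<Sum>l<k'. ((A' ^\<^sub>m n) $$ (i, l) / fact n) * T $$ (l, j))"
    by (simp add: entry[OF pow_carrier_mat[OF A'] T] sum_divide_distrib)
  also have "\<dots> = (\<Sum>l<k'. (\<Sum>n. (A' ^\<^sub>m n) $$ (i, l) / fact n) * T $$ (l, j))"
    using summable_mat_exp_entry[OF A'] i
    by (subst suminf_sum) (auto intro!: summable_mult2 sum.cong simp: suminf_mult2 simp del: times_divide_eq_left)
  also have "\<dots> = (mat_exp A' * T) $$ (i, j)"
    using A' i by (simp add: entry[OF mat_exp_carrier[OF A'] T]) (simp add: mat_exp_def)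
  finally show "(T * mat_exp A) $$ (i, j) = (mat_exp A' * T) $$ (i, j)" .
qed (use A A' T in \<open>auto simp: mat_exp_def\<close>)

subsection \<open>Linear images of state processes\<close>

lemma mult_mat_vec_entry:
  fixes T :: "'a :: comm_ring_1 mat"
  assumes "T \<in> carrier_mat k' k" "v \<in> carrier_vec k" "i < k'"
  shows "(T *\<^sub>v v) $ i = (\<Sum>l<k. T $$ (i, l) * v $ l)"
  using assms by (auto simp: scalar_prod_def atLeast0LessThan)

lemma mult_mat_entry:
  fixes T :: "'a :: comm_ring_1 mat"
  assumes "T \<in> carrier_mat k' k" "F \<in> carrier_mat k m" "i < k'" "j < m"
  shows "(T * F) $$ (i, j) = (\<Sum>l<k. T $$ (i, l) * F $$ (l, j))"
  using assms by (auto simp: scalar_prod_def atLeast0LessThan)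

section \<open>Measurability of vector-valued maps\<close>

lemma space_vec_borel: "space (vec_borel k) = carrier_vec k"
  by (simp add: vec_borel_def)

lemma measurable_vec_borel_component:
  assumes "i < k"
  shows "(\<lambda>v. v $ i) \<in> borel_measurable (vec_borel k)"
proof -
  have "(\<lambda>v. \<lambda>i\<in>{..<k}. v $ i) \<in> measurable (vec_borel k) (\<Pi>\<^sub>M i\<in>{..<k}. borel)"
    unfolding vec_borel_def by (rule measurable_vimage_algebra1) (auto simp: space_PiM)
  moreover have "(\<lambda>x. x i) \<in> borel_measurable (\<Pi>\<^sub>M i\<in>{..<k}. borel)"
    using assms by (intro measurable_component_singleton) auto
  ultimately have "(\<lambda>v. (\<lambda>i\<in>{..<k}. v $ i) i) \<in> borel_measurable (vec_borel k)"
    by (rule measurable_compose)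
  then show ?thesis using assms by simp
qed

text \<open>\<open>vec_borel\<close> is the initial sigma-algebra of the coordinate map, so
  measurability can be checked coordinate by coordinate.\<close>

lemma measurable_vec_borelI:
  assumes "f \<in> space M \<rightarrow> carrier_vec k"
    and "\<And>i. i < k \<Longrightarrow> (\<lambda>x. f x $ i) \<in> borel_measurable M"
  shows "f \<in> measurable M (vec_borel k)"
  unfolding vec_borel_def
  using assms by (intro measurable_vimage_algebra2 measurable_restrict) auto

lemma measurable_vec_borel_carrier:
  assumes "f \<in> measurable M (vec_borel k)" "x \<in> space M"
  shows "f x \<in> carrier_vec k"
  using measurable_space[OF assms] by (simp add: space_vec_borel)

lemma mult_mat_vec_measurable:
  assumes T: "T \<in> carrier_mat k' k"
  shows "(\<lambda>v. T *\<^sub>v v) \<in> measurable (vec_borel k) (vec_borel k')"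
proof (rule measurable_vec_borelI)
  fix i assume i: "i < k'"
  have "(\<lambda>v. \<Sum>l<k. T $$ (i, l) * v $ l) \<in> borel_measurable (vec_borel k)"
    by (intro borel_measurable_sum borel_measurable_times measurable_const measurable_vec_borel_component) auto
  then show "(\<lambda>v. (T *\<^sub>v v) $ i) \<in> borel_measurable (vec_borel k)"
    by (rule measurable_cong[THEN iffD1, rotated])
      (simp add: space_vec_borel mult_mat_vec_entry[OF T _ i])
qed (use T in \<open>auto simp: space_vec_borel\<close>)

section \<open>Norm estimates and null sequences of integrals\<close>

lemma eucl_norm_power2: "(eucl_norm v)\<^sup>2 = (\<Sum>i<dim_vec v. (v $ i)\<^sup>2)"
  by (simp add: eucl_norm_def scalar_prod_def atLeast0LessThan power2_eq_square sum_nonneg)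

lemma frobenius_norm_power2: "(frobenius_norm F)\<^sup>2 = (\<Sum>i<dim_row F. \<Sum>j<dim_col F. (F $$ (i, j))\<^sup>2)"
  by (simp add: frobenius_norm_def sum_nonneg)

text \<open>Cauchy-Schwarz for each row of \<open>T\<close>, summed over the rows.\<close>

lemma eucl_norm_mult_mat_vec_le:
  assumes T: "T \<in> carrier_mat k' k" and v: "v \<in> carrier_vec k"
  shows "(eucl_norm (T *\<^sub>v v))\<^sup>2 \<le> (frobenius_norm T)\<^sup>2 * (eucl_norm v)\<^sup>2"
proof -
  have "(eucl_norm (T *\<^sub>v v))\<^sup>2 = (\<Sum>i<k'. (\<Sum>l<k. T $$ (i, l) * v $ l)\<^sup>2)"
    using T v by (simp add: eucl_norm_power2 mult_mat_vec_entry[OF T v] del: index_mult_mat_vec)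
  also have "\<dots> \<le> (\<Sum>i<k'. (\<Sum>l<k. (T $$ (i, l))\<^sup>2) * (\<Sum>l<k. (v $ l)\<^sup>2))"
    by (intro sum_mono Cauchy_Schwarz_ineq_sum)
  also have "\<dots> = (frobenius_norm T)\<^sup>2 * (eucl_norm v)\<^sup>2"
    using T v by (simp add: eucl_norm_power2 frobenius_norm_power2 sum_distrib_right)
  finally show ?thesis .
qed

text \<open>The squared Frobenius norm is the sum of the squared Euclidean norms of the columns, so
  the vector estimate applies column by column.\<close>

lemma frobenius_norm_mult_le:
  assumes T: "T \<in> carrier_mat k' k" and F: "F \<in> carrier_mat k m"
  shows "(frobenius_norm (T * F))\<^sup>2 \<le> (frobenius_norm T)\<^sup>2 * (frobenius_norm F)\<^sup>2"
proof -
  have cols: "(frobenius_norm G)\<^sup>2 = (\<Sum>j<m. (eucl_norm (col G j))\<^sup>2)"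
    if "G \<in> carrier_mat n m" for G n
    using that by (simp add: frobenius_norm_power2 eucl_norm_power2) (rule sum.swap)
  have "(frobenius_norm (T * F))\<^sup>2 = (\<Sum>j<m. (eucl_norm (T *\<^sub>v col F j))\<^sup>2)"
    unfolding cols[OF mult_carrier_mat[OF T F]] by (intro sum.cong) (simp_all add: col_mult2[OF T F] del: col_mult)
  also have "\<dots> \<le> (\<Sum>j<m. (frobenius_norm T)\<^sup>2 * (eucl_norm (col F j))\<^sup>2)"
    using T F by (intro sum_mono eucl_norm_mult_mat_vec_le) auto
  finally show ?thesis
    by (simp add: cols[OF F] sum_distrib_left)
qed

text \<open>Unlike \<open>nn_integral_cmult\<close>, this needs no measurability of \<open>f\<close>.\<close>

lemma nn_integral_cmult_le:
  assumes c: "c \<ge> 0"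
  shows "(\<integral>\<^sup>+ x. ennreal c * f x \<partial>M) \<le> ennreal c * (\<integral>\<^sup>+ x. f x \<partial>M)"
proof (cases "c = 0")
  case False
  have cancel: "ennreal c * ennreal (inverse c) = 1" "ennreal (inverse c) * ennreal c = 1"
    using c False by (simp_all flip: ennreal_mult')
  show ?thesis
    unfolding nn_integral_def[of M "\<lambda>x. ennreal c * f x"]
  proof (safe intro!: SUP_least)
    fix g assume g: "simple_function M g" "g \<le> (\<lambda>x. ennreal c * f x)"
    \<comment> \<open>Dividing a simple function below \<open>c f\<close> by \<open>c\<close> gives
      a simple function below \<open>f\<close>; simple functions are measurable, so for them the
      constant can be pulled out.\<close>
    have le: "ennreal (inverse c) * g x \<le> f x" for x
      using mult_left_mono[of "g x" "ennreal c * f x" "ennreal (inverse c)"] g(2)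
      by (simp only: mult.assoc[symmetric] cancel le_fun_def mult_1_left) simp
    have "integral\<^sup>S M g = (\<integral>\<^sup>+ x. g x \<partial>M)"
      using g by (simp add: nn_integral_eq_simple_integral)
    also have "\<dots> = (\<integral>\<^sup>+ x. ennreal c * (ennreal (inverse c) * g x) \<partial>M)"
      by (simp only: mult.assoc[symmetric] cancel mult_1_left)
    also have "\<dots> = ennreal c * (\<integral>\<^sup>+ x. ennreal (inverse c) * g x \<partial>M)"
      using g by (intro nn_integral_cmult) (auto simp: borel_measurable_simple_function)
    also have "\<dots> \<le> ennreal c * (\<integral>\<^sup>+ x. f x \<partial>M)"
      by (intro mult_left_mono nn_integral_mono le) simp
    finally show "integral\<^sup>S M g \<le> ennreal c * (\<integral>\<^sup>+ x. f x \<partial>M)" .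
  qed
qed simp

text \<open>Sandwich between 0 and a constant multiple of a null sequence. It serves both error
  terms of the Levy integral, with \<open>c\<close> the squared Frobenius norm of
  \<open>T\<close>.\<close>

lemma nn_integral_tendsto_0_bounded:
  fixes f g :: "nat \<Rightarrow> 'a \<Rightarrow> real"
  assumes lim: "(\<lambda>n. \<integral>\<^sup>+ x. ennreal (f n x) \<partial>M) \<longlonglongrightarrow> 0"
    and c: "c \<ge> 0" and le: "\<And>n x. x \<in> space M \<Longrightarrow> g n x \<le> c * f n x"
  shows "(\<lambda>n. \<integral>\<^sup>+ x. ennreal (g n x) \<partial>M) \<longlonglongrightarrow> 0"
proof (rule tendsto_sandwich[OF _ _ tendsto_const])
  show "\<forall>\<^sub>F n in sequentially. (\<integral>\<^sup>+ x. ennreal (g n x) \<partial>M) \<le>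
      ennreal c * (\<integral>\<^sup>+ x. ennreal (f n x) \<partial>M)"
  proof (intro always_eventually allI)
    fix n
    have "(\<integral>\<^sup>+ x. ennreal (g n x) \<partial>M) \<le> (\<integral>\<^sup>+ x. ennreal c * ennreal (f n x) \<partial>M)"
      using le c by (intro nn_integral_mono) (simp add: ennreal_leI flip: ennreal_mult')
    also have "\<dots> \<le> ennreal c * (\<integral>\<^sup>+ x. ennreal (f n x) \<partial>M)"
      by (rule nn_integral_cmult_le[OF c])
    finally show "(\<integral>\<^sup>+ x. ennreal (g n x) \<partial>M) \<le> ennreal c * (\<integral>\<^sup>+ x. ennreal (f n x) \<partial>M)" .
  qed
  show "(\<lambda>n. ennreal c * (\<integral>\<^sup>+ x. ennreal (f n x) \<partial>M)) \<longlonglongrightarrow> 0"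
    using ennreal_tendsto_cmult[OF _ lim, of "ennreal c"] by simp
qed simp

text \<open>Pulls a row of \<open>T\<close> out of the sum over the steps. The premise is restricted
  to members of the list because only their coefficient matrices are known to have the right
  shape.\<close>

lemma sum_list_linear:
  fixes c :: "nat \<Rightarrow> 'a :: comm_ring_1"
  assumes "\<And>x. x \<in> set S \<Longrightarrow> f x = (\<Sum>l<k. c l * g l x)"
  shows "(\<Sum>x\<leftarrow>S. f x) = (\<Sum>l<k. c l * (\<Sum>x\<leftarrow>S. g l x))"
  using assms by (induction S) (simp_all add: sum.distrib distrib_left)

section \<open>Levy integrals under a linear map\<close>

definition mult_step :: "real mat \<Rightarrow> step \<Rightarrow> step" where
  "mult_step T S = map (\<lambda>(a, b, F). (a, b, T * F)) S"

lemma valid_mult_step: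
  assumes "T \<in> carrier_mat k' k" "valid_step k m S"
  shows "valid_step k' m (mult_step T S)"
  using assms by (fastforce simp: valid_step_def mult_step_def)

lemma step_fun_mult:
  assumes T: "T \<in> carrier_mat k' k" and S: "valid_step k m S"
  shows "step_fun k' m (mult_step T S) u = T * step_fun k m S u"
proof (rule eq_matI, goal_cases)
  case (1 i j)
  then have i: "i < k'" and j: "j < m" using T by (auto simp: step_fun_def)
  have "step_fun k' m (mult_step T S) u $$ (i, j) =
      (\<Sum>x\<leftarrow>S. case x of (a, b, F) \<Rightarrow> indicator {a<..b} u * (T * F) $$ (i, j))"
    using i j by (simp add: step_fun_def mult_step_def comp_def case_prod_unfold)
  also have "\<dots> = (\<Sum>l<k. T $$ (i, l) * (\<Sum>x\<leftarrow>S. case x of (a, b, F) \<Rightarrow> indicator {a<..b} u * F $$ (l, j)))"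
  proof (rule sum_list_linear)
    fix x assume x: "x \<in> set S"
    obtain a b F where [simp]: "x = (a, b, F)" by (cases x)
    have F: "F \<in> carrier_mat k m" using S x by (auto simp: valid_step_def)
    show "(case x of (a, b, F) \<Rightarrow> indicator {a<..b} u * (T * F) $$ (i, j)) =
        (\<Sum>l<k. T $$ (i, l) * (case x of (a, b, F) \<Rightarrow> indicator {a<..b} u * F $$ (l, j)))"
      by (simp add: mult_mat_entry[OF T F i j] sum_distrib_left ac_simps del: index_mult_mat)
  qed
  also have "\<dots> = (T * step_fun k m S u) $$ (i, j)"
    using T i j by (simp add: mult_mat_entry[of T k' k _ m] step_fun_def del: index_mult_mat)
  finally show ?case .
qed (use T in \<open>auto simp: step_fun_def\<close>)

text \<open>Linearity in each step, by associativity of matrix and vector products. The outcome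
  \<omega> is fixed because the dimension of \<open>L t \<omega>\<close> is guaranteed only on the
  sample space.\<close>

lemma step_integral_mult:
  assumes T: "T \<in> carrier_mat k' k" and S: "valid_step k m S" and L: "\<And>t. L t \<omega> \<in> carrier_vec m"
  shows "step_integral L k' (mult_step T S) \<omega> = T *\<^sub>v step_integral L k S \<omega>"
proof (rule eq_vecI, goal_cases)
  case (1 i)
  then have i: "i < k'" using T by auto
  have "step_integral L k' (mult_step T S) \<omega> $ i =
      (\<Sum>x\<leftarrow>S. case x of (a, b, F) \<Rightarrow> ((T * F) *\<^sub>v (L b \<omega> - L a \<omega>)) $ i)"
    using i by (simp add: step_integral_def mult_step_def comp_def case_prod_unfold)
  also have "\<dots> = (\<Sum>l<k. T $$ (i, l) * (\<Sum>x\<leftarrow>S. case x of (a, b, F) \<Rightarrow> (F *\<^sub>v (L b \<omega> - L a \<omega>)) $ l))"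
  proof (rule sum_list_linear)
    fix x assume x: "x \<in> set S"
    obtain a b F where [simp]: "x = (a, b, F)" by (cases x)
    have F: "F \<in> carrier_mat k m" using S x by (auto simp: valid_step_def)
    have "((T * F) *\<^sub>v (L b \<omega> - L a \<omega>)) = T *\<^sub>v (F *\<^sub>v (L b \<omega> - L a \<omega>))"
      using T F L by (intro assoc_mult_mat_vec) auto
    then show "(case x of (a, b, F) \<Rightarrow> ((T * F) *\<^sub>v (L b \<omega> - L a \<omega>)) $ i) =
        (\<Sum>l<k. T $$ (i, l) * (case x of (a, b, F) \<Rightarrow> (F *\<^sub>v (L b \<omega> - L a \<omega>)) $ l))"
      using mult_mat_vec_entry[OF T _ i, of "F *\<^sub>v (L b \<omega> - L a \<omega>)"] F L by simp
  qed
  also have "\<dots> = (T *\<^sub>v step_integral L k S \<omega>) $ i"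
    using T i by (simp add: mult_mat_vec_entry[of T k' k] step_integral_def del: index_mult_mat_vec)
  finally show ?case .
qed (use T in \<open>auto simp: step_integral_def\<close>)

text \<open>If the step functions \<open>S n\<close> approximate \<open>f\<close>, then
  \<open>mult_step T (S n)\<close> approximate \<open>T f\<close>: multiplication by
  \<open>T\<close> enlarges both squared errors by at most its squared Frobenius norm.\<close>

lemma has_levy_integral_mult:
  assumes f: "has_levy_integral M L k m f Z" and T: "T \<in> carrier_mat k' k"
    and L: "\<And>t. L t \<in> measurable M (vec_borel m)"
  shows "has_levy_integral M L k' m (\<lambda>u. T * f u) (\<lambda>\<omega>. T *\<^sub>v Z \<omega>)"
proof -
  from f obtain S where f_carrier: "\<And>u. f u \<in> carrier_mat k m"
    and f_meas: "\<And>i j. i < k \<Longrightarrow> j < m \<Longrightarrow> (\<lambda>u. f u $$ (i, j)) \<in> borel_measurable lborel"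
    and Z: "Z \<in> measurable M (vec_borel k)" and S: "\<And>n. valid_step k m (S n)"
    and lim_f: "(\<lambda>n. \<integral>\<^sup>+ u. ennreal ((frobenius_norm (f u - step_fun k m (S n) u))\<^sup>2) \<partial>lborel) \<longlonglongrightarrow> 0"
    and lim_Z: "(\<lambda>n. \<integral>\<^sup>+ \<omega>. ennreal ((eucl_norm (Z \<omega> - step_integral L k (S n) \<omega>))\<^sup>2) \<partial>M) \<longlonglongrightarrow> 0"
    by (auto simp: has_levy_integral_def)
  have step_carrier: "step_fun k m s u \<in> carrier_mat k m" for s u
    by (simp add: step_fun_def)
  have step_integral_carrier: "step_integral L k s \<omega> \<in> carrier_vec k" for s \<omega>
    by (simp add: step_integral_def)
  have "(\<lambda>u. \<Sum>l<k. T $$ (i, l) * f u $$ (l, j)) \<in> borel_measurable lborel" if "j < m" for i j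
    using that by (intro borel_measurable_sum borel_measurable_times f_meas) auto
  then have "(\<lambda>u. (T * f u) $$ (i, j)) \<in> borel_measurable lborel" if "i < k'" "j < m" for i j
    using that by (simp only: mult_mat_entry[OF T f_carrier that])
  moreover have "(\<lambda>n. \<integral>\<^sup>+ u. ennreal ((frobenius_norm (T * f u - step_fun k' m (mult_step T (S n)) u))\<^sup>2) \<partial>lborel)
      \<longlonglongrightarrow> 0"
  proof (rule nn_integral_tendsto_0_bounded[OF lim_f])
    fix n u
    have "T * f u - step_fun k' m (mult_step T (S n)) u = T * (f u - step_fun k m (S n) u)"
      using mult_minus_distrib_mat[OF T f_carrier step_carrier] by (simp add: step_fun_mult[OF T S])
    then show "(frobenius_norm (T * f u - step_fun k' m (mult_step T (S n)) u))\<^sup>2 \<le>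
        (frobenius_norm T)\<^sup>2 * (frobenius_norm (f u - step_fun k m (S n) u))\<^sup>2"
      using frobenius_norm_mult_le[OF T minus_carrier_mat[OF step_carrier]] by simp
  qed simp
  moreover have "(\<lambda>n. \<integral>\<^sup>+ \<omega>. ennreal ((eucl_norm (T *\<^sub>v Z \<omega> - step_integral L k' (mult_step T (S n)) \<omega>))\<^sup>2) \<partial>M)
      \<longlonglongrightarrow> 0"
  proof (rule nn_integral_tendsto_0_bounded[OF lim_Z])
    fix n \<omega> assume \<omega>: "\<omega> \<in> space M"
    note Z\<omega> = measurable_vec_borel_carrier[OF Z \<omega>] and L\<omega> = measurable_vec_borel_carrier[OF L \<omega>]
    have "T *\<^sub>v Z \<omega> - step_integral L k' (mult_step T (S n)) \<omega> = T *\<^sub>v (Z \<omega> - step_integral L k (S n) \<omega>)"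
      using mult_minus_distrib_mat_vec[OF T Z\<omega> step_integral_carrier]
      by (simp add: step_integral_mult[where L = L, OF T S L\<omega>])
    then show "(eucl_norm (T *\<^sub>v Z \<omega> - step_integral L k' (mult_step T (S n)) \<omega>))\<^sup>2 \<le>
        (frobenius_norm T)\<^sup>2 * (eucl_norm (Z \<omega> - step_integral L k (S n) \<omega>))\<^sup>2"
      using eucl_norm_mult_mat_vec_le[OF T minus_carrier_vec[OF Z\<omega> step_integral_carrier]] by simp
  qed simp
  moreover have "(\<lambda>\<omega>. T *\<^sub>v Z \<omega>) \<in> measurable M (vec_borel k')"
    by (rule measurable_compose[OF Z mult_mat_vec_measurable[OF T]])
  ultimately show ?thesis
    unfolding has_levy_integral_def
    using valid_mult_step[OF T S] mult_carrier_mat[OF T f_carrier]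
    by (intro conjI exI[of _ "\<lambda>n. mult_step T (S n)"]) blast+
qed

section \<open>Stationarity and causality under a linear map\<close>

lemma strictly_stationary_mult:
  assumes X: "strictly_stationary M k X" and T: "T \<in> carrier_mat k' k"
  shows "strictly_stationary M k' (\<lambda>t \<omega>. T *\<^sub>v X t \<omega>)"
proof -
  have X_meas: "X t \<in> measurable M (vec_borel k)" for t
    using X by (simp add: strictly_stationary_def)
  have "distr M (\<Pi>\<^sub>M t\<in>J. vec_borel k') (\<lambda>\<omega>. \<lambda>t\<in>J. T *\<^sub>v X (t + h) \<omega>) =
      distr M (\<Pi>\<^sub>M t\<in>J. vec_borel k') (\<lambda>\<omega>. \<lambda>t\<in>J. T *\<^sub>v X t \<omega>)" if J: "finite J" for J h
  proof -
    define \<Phi> where "\<Phi> x = (\<lambda>t\<in>J. T *\<^sub>v x t)" for x :: "real \<Rightarrow> real vec"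
    have \<Phi>: "\<Phi> \<in> measurable (\<Pi>\<^sub>M t\<in>J. vec_borel k) (\<Pi>\<^sub>M t\<in>J. vec_borel k')"
      unfolding \<Phi>_def
      by (intro measurable_restrict
          measurable_compose[OF _ mult_mat_vec_measurable[OF T]] measurable_component_singleton)
    \<comment> \<open>The law of the image process is the image under \<Phi> of the law of
      \<open>X\<close>. Taking \<open>s = h\<close> and \<open>s = 0\<close> reduces the claim to
      the stationarity of \<open>X\<close>.\<close>
    have push: "distr M (\<Pi>\<^sub>M t\<in>J. vec_borel k') (\<lambda>\<omega>. \<lambda>t\<in>J. T *\<^sub>v X (t + s) \<omega>) =
        distr (distr M (\<Pi>\<^sub>M t\<in>J. vec_borel k) (\<lambda>\<omega>. \<lambda>t\<in>J. X (t + s) \<omega>)) (\<Pi>\<^sub>M t\<in>J. vec_borel k') \<Phi>" for s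
    proof (subst distr_distr[OF \<Phi>])
      show "(\<lambda>\<omega>. \<lambda>t\<in>J. X (t + s) \<omega>) \<in> measurable M (\<Pi>\<^sub>M t\<in>J. vec_borel k)"
        using X_meas by (intro measurable_restrict)
    qed (auto intro!: distr_cong simp: \<Phi>_def)
    show ?thesis
      using X J push[of h] push[of 0] by (simp add: strictly_stationary_def)
  qed
  then show ?thesis
    using measurable_compose[OF X_meas mult_mat_vec_measurable[OF T]]
    by (simp add: strictly_stationary_def)
qed

lemma causal_mult:
  assumes X: "causal M m k L X" and T: "T \<in> carrier_mat k' k"
  shows "causal M m k' L (\<lambda>t \<omega>. T *\<^sub>v X t \<omega>)"
  unfolding causal_def
proof
  fix t
  obtain Z where Z: "Z \<in> measurable (past M m L t) (vec_borel k)" "AE \<omega> in M. X t \<omega> = Z \<omega>"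
    using X unfolding causal_def by blast
  show "\<exists>Z\<in>measurable (past M m L t) (vec_borel k'). AE \<omega> in M. T *\<^sub>v X t \<omega> = Z \<omega>"
  proof
    show "(\<lambda>\<omega>. T *\<^sub>v Z \<omega>) \<in> measurable (past M m L t) (vec_borel k')"
      by (rule measurable_compose[OF Z(1) mult_mat_vec_measurable[OF T]])
  qed (use Z(2) in auto)
qed

section \<open>The state equation under a linear map\<close>

lemma set_integral_linear_combination:
  fixes c :: "nat \<Rightarrow> real"
  assumes "\<And>l. l < k \<Longrightarrow> set_integrable M S (g l)"
  shows "set_integrable M S (\<lambda>u. \<Sum>l<k. c l * g l u)"
    and "(LINT u:S|M. (\<Sum>l<k. c l * g l u)) = (\<Sum>l<k. c l * (LINT u:S|M. g l u))"
proof -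
  have eq: "indicator S u *\<^sub>R (\<Sum>l<k. c l * g l u) = (\<Sum>l<k. c l * (indicator S u *\<^sub>R g l u))" for u
    by (simp add: sum_distrib_left ac_simps)
  have int: "integrable M (\<lambda>u. c l * (indicator S u *\<^sub>R g l u))" if "l < k" for l
    using assms[OF that] by (intro integrable_mult_right) (simp add: set_integrable_def)
  show "set_integrable M S (\<lambda>u. \<Sum>l<k. c l * g l u)"
    unfolding set_integrable_def eq using int by (intro Bochner_Integration.integrable_sum) auto
  have "(LINT u:S|M. (\<Sum>l<k. c l * g l u)) = (\<Sum>l<k. LINT u|M. c l * (indicator S u *\<^sub>R g l u))"
    unfolding set_lebesgue_integral_def eq using int by (intro Bochner_Integration.integral_sum) auto
  also have "\<dots> = (\<Sum>l<k. c l * (LINT u:S|M. g l u))"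
    by (simp only: set_lebesgue_integral_def integral_mult_right_zero)
  finally show "(LINT u:S|M. (\<Sum>l<k. c l * g l u)) = (\<Sum>l<k. c l * (LINT u:S|M. g l u))" .
qed

text \<open>Apply \<open>T\<close> to the integrated equation, move it under the time integral and
  replace \<open>T A\<close> by \<open>A' T\<close>.\<close>

lemma solves_state_equation_mult:
  assumes X: "solves_state_equation M L k A B X"
    and A: "A \<in> carrier_mat k k" and B: "B \<in> carrier_mat k m"
    and A': "A' \<in> carrier_mat k' k'" and T: "T \<in> carrier_mat k' k" and TA: "T * A = A' * T"
    and X_meas: "\<And>t. X t \<in> measurable M (vec_borel k)" and L: "\<And>t. L t \<in> measurable M (vec_borel m)"
  shows "solves_state_equation M L k' A' (T * B) (\<lambda>t \<omega>. T *\<^sub>v X t \<omega>)"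
  unfolding solves_state_equation_def
  \<comment> \<open>\<open>AE_space\<close> restricts to outcomes in the sample space, where all
    vectors have the right dimension.\<close>
  using X[unfolded solves_state_equation_def] AE_space
proof eventually_elim
  case (elim \<omega>)
  note X\<omega> = measurable_vec_borel_carrier[OF X_meas elim(2)]
    and L\<omega> = measurable_vec_borel_carrier[OF L elim(2)]
  show ?case
  proof (intro allI impI conjI)
    fix s t :: real and i assume st: "s \<le> t" and i: "i < k'"
    have "set_integrable lborel {s..t} (\<lambda>u. \<Sum>l<k. T $$ (i, l) * X u \<omega> $ l)"
      using elim(1) st by (intro set_integral_linear_combination(1)) auto
    then show "set_integrable lborel {s..t} (\<lambda>u. (T *\<^sub>v X u \<omega>) $ i)"
      by (simp only: mult_mat_vec_entry[OF T X\<omega> i])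
  next
    fix s t :: real assume st: "s \<le> t"
    define I where "I = vec k (\<lambda>i. LINT u:{s..t}|lborel. (A *\<^sub>v X u \<omega>) $ i)"
    \<comment> \<open>The equation supplies integrability of the coordinates of \<open>X\<close>
      only; moving \<open>T\<close> under the integral needs it for those of
      \<open>A X\<close>.\<close>
    have AX: "set_integrable lborel {s..t} (\<lambda>u. (A *\<^sub>v X u \<omega>) $ i)" if "i < k" for i
    proof -
      have "set_integrable lborel {s..t} (\<lambda>u. \<Sum>l<k. A $$ (i, l) * X u \<omega> $ l)"
        using elim(1) st by (intro set_integral_linear_combination(1)) auto
      then show ?thesis by (simp only: mult_mat_vec_entry[OF A X\<omega> that])
    qed
    have TI: "T *\<^sub>v I = vec k' (\<lambda>i. LINT u:{s..t}|lborel. (A' *\<^sub>v (T *\<^sub>v X u \<omega>)) $ i)"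
    proof (rule eq_vecI, goal_cases)
      case (1 i)
      then have i: "i < k'" by simp
      have "A' *\<^sub>v (T *\<^sub>v X u \<omega>) = T *\<^sub>v (A *\<^sub>v X u \<omega>)" for u
        using assoc_mult_mat_vec[OF T A X\<omega>[of u]] assoc_mult_mat_vec[OF A' T X\<omega>[of u]] TA by simp
      then have "(LINT u:{s..t}|lborel. (A' *\<^sub>v (T *\<^sub>v X u \<omega>)) $ i) =
          (LINT u:{s..t}|lborel. (\<Sum>l<k. T $$ (i, l) * (A *\<^sub>v X u \<omega>) $ l))"
        using mult_mat_vec_entry[OF T mult_mat_vec_carrier[OF A X\<omega>] i] by simp
      also have "\<dots> = (\<Sum>l<k. T $$ (i, l) * (LINT u:{s..t}|lborel. (A *\<^sub>v X u \<omega>) $ l))"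
        by (rule set_integral_linear_combination(2)[OF AX])
      also have "\<dots> = (T *\<^sub>v I) $ i"
        using T i by (simp add: mult_mat_vec_entry[OF T _ i] I_def del: index_mult_mat_vec)
      finally show ?case using i by simp
    qed (use T in auto)
    have "T *\<^sub>v X t \<omega> - T *\<^sub>v X s \<omega> = T *\<^sub>v (X t \<omega> - X s \<omega>)"
      using mult_minus_distrib_mat_vec[OF T X\<omega> X\<omega>] by simp
    also have "X t \<omega> - X s \<omega> = I + B *\<^sub>v (L t \<omega> - L s \<omega>)"
      using elim(1) st unfolding I_def by blast
    also have "T *\<^sub>v \<dots> = T *\<^sub>v I + T *\<^sub>v (B *\<^sub>v (L t \<omega> - L s \<omega>))"
      using T B L\<omega> by (intro mult_add_distrib_mat_vec) (auto simp: I_def)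
    also have "T *\<^sub>v (B *\<^sub>v (L t \<omega> - L s \<omega>)) = T * B *\<^sub>v (L t \<omega> - L s \<omega>)"
      using T B L\<omega> by (intro assoc_mult_mat_vec[symmetric]) auto
    finally show "T *\<^sub>v X t \<omega> - T *\<^sub>v X s \<omega> =
        vec k' (\<lambda>i. LINT u:{s..t}|lborel. (A' *\<^sub>v (T *\<^sub>v X u \<omega>)) $ i) + T * B *\<^sub>v (L t \<omega> - L s \<omega>)"
      by (simp add: TI)
  qed
qed

text \<open>The state equation, stationarity, causality and the moving average are transported one
  by one. The moving average needs the intertwining of the flows, hence of all multiples of
  \<open>A\<close> and \<open>A'\<close>.\<close>

lemma state_process_mult:
  assumes X: "state_process M L k m A B X"
    and A: "A \<in> carrier_mat k k" and B: "B \<in> carrier_mat k m"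
    and A': "A' \<in> carrier_mat k' k'" and T: "T \<in> carrier_mat k' k" and TA: "T * A = A' * T"
    and L: "\<And>t. L t \<in> measurable M (vec_borel m)"
  shows "state_process M L k' m A' (T * B) (\<lambda>t \<omega>. T *\<^sub>v X t \<omega>)"
proof -
  note X' = X[unfolded state_process_def]
  have X_meas: "\<And>t. X t \<in> measurable M (vec_borel k)"
    using X' by (simp add: strictly_stationary_def)
  have "T * (c \<cdot>\<^sub>m A) = (c \<cdot>\<^sub>m A') * T" for c
    using mult_smult_distrib[OF T A] mult_smult_assoc_mat[OF A' T] TA by simp
  then have "T * mat_exp (c \<cdot>\<^sub>m A) = mat_exp (c \<cdot>\<^sub>m A') * T" for c
    using A A' T by (intro mat_exp_intertwine) auto
  \<comment> \<open>The moving average kernel of \<open>(A, B)\<close> at lag \<open>c\<close> is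
    carried to that of \<open>(A', T B)\<close>.\<close>
  then have kernel: "T * (mat_exp (c \<cdot>\<^sub>m A) * B) = mat_exp (c \<cdot>\<^sub>m A') * (T * B)" for c
    using assoc_mult_mat[OF T mat_exp_carrier[OF smult_carrier_mat[OF A]] B, of c]
      assoc_mult_mat[OF mat_exp_carrier[OF smult_carrier_mat[OF A']] T B, of c] by simp
  have "has_levy_integral M L k' m
      (\<lambda>u. if u \<le> t then mat_exp ((t - u) \<cdot>\<^sub>m A') * (T * B) else 0\<^sub>m k' m) (\<lambda>\<omega>. T *\<^sub>v X t \<omega>)" for t
    using has_levy_integral_mult[OF X'[THEN conjunct2, THEN conjunct2, THEN conjunct2, THEN spec] T L, of t]
      right_mult_zero_mat[OF T]
    by (simp add: if_distrib[of "\<lambda>F. T * F"] kernel cong: if_cong)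
  then show ?thesis
    using solves_state_equation_mult[OF _ A B A' T TA X_meas L] strictly_stationary_mult[OF _ T]
      causal_mult[OF _ T] X'
    by (auto simp: state_process_def)
qed

subsection \<open>Companion and observability matrices\<close>

text \<open>The Kronecker product of the companion matrix of
  \<open>z^p + a_(p-1) z^(p-1) + ... + a_0\<close> with the identity of size \<open>d\<close>;
  \<open>a c\<close> belongs to the power \<open>z^c\<close>.\<close>

definition block_companion :: "nat \<Rightarrow> nat \<Rightarrow> (nat \<Rightarrow> real) \<Rightarrow> real mat" where
  "block_companion d p a = block_mat p p d d
     (\<lambda>r c. if r = p - 1 then - (a c \<cdot>\<^sub>m 1\<^sub>m d) else if c = r + 1 then 1\<^sub>m d else 0\<^sub>m d d)"

lemma block_companion_carrier: "block_companion d p a \<in> carrier_mat (p * d) (p * d)"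
  by (simp add: block_companion_def block_mat_carrier)

lemma block_index_less:
  assumes "r < p" "s < (d::nat)"
  shows "r * d + s < p * d"
proof -
  have "r * d + s < Suc r * d" using assms by simp
  also have "\<dots> \<le> p * d" using assms by (intro mult_le_mono1) simp
  finally show ?thesis .
qed

lemma eigenvalue_block_companion:
  assumes p: "p \<ge> 1" and z: "eigenvalue (map_mat complex_of_real (block_companion d p a)) z"
  shows "z ^ p + (\<Sum>c<p. of_real (a c) * z ^ c) = 0"
proof (rule ccontr)
  assume nonroot: "z ^ p + (\<Sum>c<p. of_real (a c) * z ^ c) \<noteq> 0"
  let ?A = "map_mat complex_of_real (block_companion d p a)"
  have A: "?A \<in> carrier_mat (p * d) (p * d)"
    using block_companion_carrier[of d p a] by simp
  from z A obtain v where v: "v \<in> carrier_vec (p * d)" "v \<noteq> 0\<^sub>v (p * d)" and Av: "?A *\<^sub>v v = z \<cdot>\<^sub>v v"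
    by (auto simp: eigenvalue_def eigenvector_def)
  have row: "z * v $ (r * d + s) = (\<Sum>c<p. \<Sum>e<d. ?A $$ (r * d + s, c * d + e) * v $ (c * d + e))"
    if "r < p" "s < d" for r s
  proof -
    note i = block_index_less[OF that]
    have "z * v $ (r * d + s) = (?A *\<^sub>v v) $ (r * d + s)"
      using v i by (simp add: Av)
    also have "\<dots> = (\<Sum>l<p * d. ?A $$ (r * d + s, l) * v $ l)"
      by (rule mult_mat_vec_entry[OF A v(1) i])
    finally show ?thesis by (simp only: sum_blocks)
  qed
  have entry: "?A $$ (r * d + s, c * d + e) = (if e = s then
      (if r = p - 1 then - of_real (a c) else if c = r + 1 then 1 else 0) else 0)"
    if "r < p" "s < d" "c < p" "e < d" for r s c e
    using that block_index_less[of r p s d] block_index_less[of c p e d]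
    by (simp add: block_companion_def block_mat_def)
  have row_sum: "z * v $ (r * d + s) =
      (\<Sum>c<p. (if r = p - 1 then - of_real (a c) else if c = r + 1 then 1 else 0) * v $ (c * d + s))"
    if "r < p" "s < d" for r s
    unfolding row[OF that]
  proof (intro sum.cong refl)
    fix c assume "c \<in> {..<p}"
    then have "(\<Sum>e<d. ?A $$ (r * d + s, c * d + e) * v $ (c * d + e)) = (\<Sum>e<d. if e = s then
        (if r = p - 1 then - of_real (a c) else if c = r + 1 then 1 else 0) * v $ (c * d + s) else 0)"
      using that by (intro sum.cong refl) (subst entry, auto)
    then show "(\<Sum>e<d. ?A $$ (r * d + s, c * d + e) * v $ (c * d + e)) =
        (if r = p - 1 then - of_real (a c) else if c = r + 1 then 1 else 0) * v $ (c * d + s)"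
      using that by simp
  qed
  have powers: "v $ (r * d + s) = z ^ r * v $ s" if "r < p" "s < d" for r s
    using that
  proof (induction r)
    case (Suc r)
    then have "r \<noteq> p - 1" by simp
    then have "z * v $ (r * d + s) = v $ (Suc r * d + s)"
      using Suc.prems by (subst row_sum) (auto simp: if_distrib[of "\<lambda>x. x * _"] cong: if_cong)
    then show ?case using Suc by (simp add: mult.assoc)
  qed simp
  have "v $ s = 0" if s: "s < d" for s
  proof -
    have "z ^ p * v $ s = z * v $ ((p - 1) * d + s)"
      using p powers[of "p - 1" s] s power_minus_mult[of p z]
      by (simp add: mult.assoc[symmetric] mult.commute[of z])
    also have "\<dots> = (\<Sum>c<p. - of_real (a c) * v $ (c * d + s))"
      using p s by (subst row_sum) auto
    also have "\<dots> = - (\<Sum>c<p. of_real (a c) * z ^ c) * v $ s"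
      using s by (simp add: powers sum_distrib_right sum_negf mult.assoc)
    finally have "(z ^ p + (\<Sum>c<p. of_real (a c) * z ^ c)) * v $ s = 0"
      by (simp add: algebra_simps)
    then show ?thesis using nonroot by simp
  qed
  then have "v $ i = 0" if "i < p * d" for i
    using powers[OF block_index[OF that]] block_index[OF that] by simp
  then show False using v by auto
qed

lemma block_companion_mcarma_form:
  assumes p: "p \<ge> 1" and \<beta>: "\<And>k. \<beta> k \<in> carrier_mat d m"
  shows "mcarma_form d m p (block_companion d p a) (block_mat p 1 d m (\<lambda>r c. \<beta> (r + 1)))
    (block_mat 1 p d d (\<lambda>r c. if c = 0 then 1\<^sub>m d else 0\<^sub>m d d))"
proof -
  define A where "A i = a (p - i) \<cdot>\<^sub>m 1\<^sub>m d" for i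
  define S where "S k = mat_sum d m (\<lambda>i. A i * \<beta> (k - i)) {1..k - 1}" for k
  \<comment> \<open>The recursion with \<open>q = p - 1\<close>, solved for its inhomogeneity.\<close>
  define B where "B i = \<beta> (i + 1) + S (i + 1)" for i
  have S: "S k \<in> carrier_mat d m" for k
    by (simp add: S_def mat_sum_def)
  have \<beta>_eq: "\<beta> k = - S k + B (k - 1)" if "k \<ge> 1" for k
    using \<beta>[of k] S[of k] that by (intro eq_matI) (auto simp: B_def)
  have \<beta>_rec: "\<beta> (p - j) = - mat_sum d m (\<lambda>i. A i * \<beta> (p - j - i)) {1..p - j - 1} + B (p - 1 - j)"
    if "j < p" for j
  proof -
    have idx: "p - 1 - j = p - j - 1" by simp
    show ?thesis
      unfolding idx S_def[symmetric] using that by (intro \<beta>_eq) simp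
  qed
  have q: "p - 1 < p" using p by simp
  show ?thesis
    unfolding mcarma_form_def
  proof (rule exI, rule conjI[OF q], rule exI[of _ A], rule exI[of _ B], rule exI[of _ \<beta>],
      intro conjI ballI allI impI refl)
    show "block_companion d p a = block_mat p p d d
        (\<lambda>r c. if r = p - 1 then - A (p - c) else if c = r + 1 then 1\<^sub>m d else 0\<^sub>m d d)"
      unfolding block_companion_def by (intro block_mat_cong) (auto simp: A_def)
  next
    fix j assume "j < p"
    then have j: "j \<in> {0..p - 1}" by simp
    show "\<beta> (p - j) = (if j \<in> {0..p - 1}
        then - mat_sum d m (\<lambda>i. A i * \<beta> (p - j - i)) {1..p - j - 1} + B (p - 1 - j) else 0\<^sub>m d m)"
      unfolding if_P[OF j] by (intro \<beta>_rec \<open>j < p\<close>)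
  qed (use p \<beta> S in \<open>auto simp: A_def B_def\<close>)
qed

definition observability_mat :: "nat \<Rightarrow> nat \<Rightarrow> nat \<Rightarrow> real mat \<Rightarrow> real mat \<Rightarrow> real mat" where
  "observability_mat d N p A C = block_mat p 1 d N (\<lambda>r _. C * A ^\<^sub>m r)"

lemma observability_mat_carrier: "observability_mat d N p A C \<in> carrier_mat (p * d) N"
  using block_mat_carrier[of p 1 d N] by (simp add: observability_mat_def)

lemma observability_mat_mult:
  assumes "A \<in> carrier_mat N N" "C \<in> carrier_mat d N" "B \<in> carrier_mat N n"
  shows "observability_mat d N p A C * B = block_mat p 1 d n (\<lambda>r _. C * A ^\<^sub>m r * B)"
  unfolding observability_mat_def using assms
  by (intro block_column_mult mult_carrier_mat[OF _ pow_carrier_mat])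

lemma observability_mat_intertwine:
  assumes A: "A \<in> carrier_mat N N" and C: "C \<in> carrier_mat d N"
    and annihilates: "\<And>i j. i < N \<Longrightarrow> j < N \<Longrightarrow>
      (A ^\<^sub>m p) $$ (i, j) + (\<Sum>x<p. a x * (A ^\<^sub>m x) $$ (i, j)) = 0"
  shows "observability_mat d N p A C * A = block_companion d p a * observability_mat d N p A C"
proof -
  define F where "F r c = (if r = p - 1 then - (a c \<cdot>\<^sub>m 1\<^sub>m d) else if c = r + 1 then 1\<^sub>m d else 0\<^sub>m d d)"
    for r c
  have F: "F r c \<in> carrier_mat d d" for r c by (simp add: F_def)
  have CA: "C * A ^\<^sub>m r \<in> carrier_mat d N" for r
    using C pow_carrier_mat[OF A] by (rule mult_carrier_mat)
  have "block_companion d p a * observability_mat d N p A C =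
      block_mat p 1 d N (\<lambda>r _. mat_sum d N (\<lambda>x. F r x * (C * A ^\<^sub>m x)) {..<p})"
    unfolding block_companion_def observability_mat_def F_def[symmetric]
    by (intro block_mat_mult F CA)
  also have "\<dots> = block_mat p 1 d N (\<lambda>r _. C * A ^\<^sub>m r * A)"
  proof (intro block_mat_cong eq_matI)
    fix r s j
    assume r: "r < p" and "s < dim_row (C * A ^\<^sub>m r * A)" "j < dim_col (C * A ^\<^sub>m r * A)"
    then have s: "s < d" and j: "j < N" using A C by auto
    have entry: "(F r x * (C * A ^\<^sub>m x)) $$ (s, j) =
        (if r = p - 1 then - a x else if x = r + 1 then 1 else 0) * (C * A ^\<^sub>m x) $$ (s, j)" for x
    proof -
      have "(F r x * (C * A ^\<^sub>m x)) $$ (s, j) = (\<Sum>e<d. F r x $$ (s, e) * (C * A ^\<^sub>m x) $$ (e, j))"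
        by (rule mult_mat_entry[OF F CA s j])
      also have "\<dots> = (\<Sum>e<d. if e = s then
          (if r = p - 1 then - a x else if x = r + 1 then 1 else 0) * (C * A ^\<^sub>m x) $$ (s, j) else 0)"
        using s by (intro sum.cong refl) (auto simp: F_def simp del: index_mult_mat)
      finally show ?thesis using s by simp
    qed
    have step: "C * A ^\<^sub>m r * A = C * A ^\<^sub>m Suc r"
      using assoc_mult_mat[OF C pow_carrier_mat[OF A] A] by simp
    have "(\<Sum>x<p. (F r x * (C * A ^\<^sub>m x)) $$ (s, j)) = (C * A ^\<^sub>m Suc r) $$ (s, j)"
    proof (cases "r = p - 1")
      case True
      have "0 = (\<Sum>l<N. C $$ (s, l) * ((A ^\<^sub>m p) $$ (l, j) + (\<Sum>x<p. a x * (A ^\<^sub>m x) $$ (l, j))))"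
        using j by (simp add: annihilates)
      also have "\<dots> = (\<Sum>l<N. C $$ (s, l) * (A ^\<^sub>m p) $$ (l, j)) +
          (\<Sum>x<p. a x * (\<Sum>l<N. C $$ (s, l) * (A ^\<^sub>m x) $$ (l, j)))"
        by (simp add: distrib_left sum.distrib sum_distrib_left mult.left_commute) (rule sum.swap)
      also have "\<dots> = (C * A ^\<^sub>m p) $$ (s, j) + (\<Sum>x<p. a x * (C * A ^\<^sub>m x) $$ (s, j))"
        by (simp only: mult_mat_entry[OF C pow_carrier_mat[OF A] s j])
      moreover have "Suc r = p" using True r by simp
      ultimately show ?thesis
        unfolding entry using True by (simp add: sum_negf del: index_mult_mat pow_mat.simps)
    next
      case False
      then have "Suc r < p" using r by simp
      moreover have "(\<Sum>x<p. (F r x * (C * A ^\<^sub>m x)) $$ (s, j)) =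
          (\<Sum>x<p. if x = Suc r then (C * A ^\<^sub>m x) $$ (s, j) else 0)"
        using False by (intro sum.cong refl) (simp only: entry, simp del: index_mult_mat pow_mat.simps)
      ultimately show ?thesis by (simp del: index_mult_mat pow_mat.simps)
    qed
    then show "mat_sum d N (\<lambda>x. F r x * (C * A ^\<^sub>m x)) {..<p} $$ (s, j) = (C * A ^\<^sub>m r * A) $$ (s, j)"
      using s j by (simp add: mat_sum_def step del: index_mult_mat pow_mat.simps)
  qed (use A C in \<open>auto simp: mat_sum_def\<close>)
  also have "\<dots> = observability_mat d N p A C * A"
    by (rule observability_mat_mult[OF A C A, symmetric])
  finally show ?thesis ..
qed

lemma first_block_observability_mat:
  assumes p: "p \<ge> 1" and A: "A \<in> carrier_mat N N" and C: "C \<in> carrier_mat d N"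
  shows "block_mat 1 p d d (\<lambda>r c. if c = 0 then 1\<^sub>m d else 0\<^sub>m d d) * observability_mat d N p A C = C"
proof -
  have CA: "C * A ^\<^sub>m r \<in> carrier_mat d N" for r
    using C pow_carrier_mat[OF A] by (rule mult_carrier_mat)
  have "block_mat 1 p d d (\<lambda>r c. if c = 0 then 1\<^sub>m d else 0\<^sub>m d d) * observability_mat d N p A C =
      block_mat 1 1 d N (\<lambda>_ _. mat_sum d N (\<lambda>x. (if x = 0 then 1\<^sub>m d else 0\<^sub>m d d) * (C * A ^\<^sub>m x)) {..<p})"
    unfolding observability_mat_def by (intro block_mat_mult CA) auto
  also have "mat_sum d N (\<lambda>x. (if x = 0 then 1\<^sub>m d else 0\<^sub>m d d) * (C * A ^\<^sub>m x)) {..<p} = C"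
  proof (rule eq_matI)
    fix s j assume "s < dim_row C" "j < dim_col C"
    then have s: "s < d" and j: "j < N" using C by auto
    have "((if x = 0 then 1\<^sub>m d else 0\<^sub>m d d) * (C * A ^\<^sub>m x)) $$ (s, j) = (if x = 0 then C $$ (s, j) else 0)"
      for x
      using left_mult_one_mat[OF CA[of 0]] left_mult_zero_mat[OF CA[of x]] right_mult_one_mat[OF C]
        carrier_matD(1)[OF A] s j by (simp del: index_mult_mat)
    then show "mat_sum d N (\<lambda>x. (if x = 0 then 1\<^sub>m d else 0\<^sub>m d d) * (C * A ^\<^sub>m x)) {..<p} $$ (s, j) =
        C $$ (s, j)"
      using p s j by (simp add: mat_sum_def del: index_mult_mat)
  qed (use C in \<open>auto simp: mat_sum_def\<close>)
  finally show ?thesis by (simp only: block_mat_single[OF C])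
qed

lemma poly_char_poly_of_real:
  assumes A: "A \<in> carrier_mat N N"
  shows "poly (char_poly (map_mat complex_of_real A)) z =
    z ^ N + (\<Sum>c<N. of_real (coeff (char_poly A) c) * z ^ c)"
proof -
  have \<chi>: "degree (char_poly A) = N" "coeff (char_poly A) N = 1"
    using degree_monic_char_poly[OF A] by auto
  have "char_poly (map_mat complex_of_real A) = map_poly of_real (char_poly A)"
    by (rule of_real_hom.char_poly_hom[OF A])
  then have "poly (char_poly (map_mat complex_of_real A)) z = (\<Sum>c\<le>N. of_real (coeff (char_poly A) c) * z ^ c)"
    by (simp add: poly_altdef coeff_map_poly degree_map_poly \<chi>)
  then show ?thesis
    by (simp add: lessThan_Suc_atMost[symmetric] \<chi> add.commute)
qed

lemma stable_block_companion:
  assumes A: "A \<in> carrier_mat N N" and "N \<ge> 1" and "stable_mat A"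
  shows "stable_mat (block_companion d N (coeff (char_poly A)))"
  unfolding stable_mat_def
proof (intro allI impI)
  fix z assume "eigenvalue (map_mat complex_of_real (block_companion d N (coeff (char_poly A)))) z"
  then have "poly (char_poly (map_mat complex_of_real A)) z = 0"
    using eigenvalue_block_companion[OF assms(2)] by (simp add: poly_char_poly_of_real[OF A])
  then have "eigenvalue (map_mat complex_of_real A) z"
    using A eigenvalue_root_char_poly[of "map_mat complex_of_real A" N z] by simp
  then show "Re z < 0" using assms(3) by (simp add: stable_mat_def)
qed

subsection \<open>Transition to the canonical form\<close>

theorem proposition2p1:
  fixes M :: "'w measure" and L Y :: "real \<Rightarrow> 'w \<Rightarrow> real vec"
    and d m N :: nat and A B C :: "real mat"
  assumes "d \<ge> 1" and "m \<ge> 1" and "N \<ge> 1"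
    and "two_sided_levy M m L"
    and "\<And>i. i < m \<Longrightarrow> integrable M (\<lambda>\<omega>. L 1 \<omega> $ i)"
    and "\<And>i. i < m \<Longrightarrow> (\<integral>\<omega>. L 1 \<omega> $ i \<partial>M) = 0"
    and "integrable M (\<lambda>\<omega>. (eucl_norm (L 1 \<omega>))\<^sup>2)"
    and "A \<in> carrier_mat N N" and "B \<in> carrier_mat N m" and "C \<in> carrier_mat d N"
    and "stable_mat A"
    and "output_process M L N m d A B C Y"
  shows "\<exists>p \<A> \<B> \<C>. p \<ge> 1 \<and>
    \<A> \<in> carrier_mat (p * d) (p * d) \<and> \<B> \<in> carrier_mat (p * d) m \<and> \<C> \<in> carrier_mat d (p * d) \<and>
    mcarma_form d m p \<A> \<B> \<C> \<and>
    output_process M L (p * d) m d \<A> \<B> \<C> Y"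
proof -
  note A = \<open>A \<in> carrier_mat N N\<close> and B = \<open>B \<in> carrier_mat N m\<close> and C = \<open>C \<in> carrier_mat d N\<close>
  define a where "a = coeff (char_poly A)"
  define \<A> where "\<A> = block_companion d N a"
  define \<C> where "\<C> = block_mat 1 N d d (\<lambda>r c. if c = 0 then 1\<^sub>m d else 0\<^sub>m d d)"
  define T where "T = observability_mat d N N A C"
  define \<beta> where "\<beta> k = C * A ^\<^sub>m (k - 1) * B" for k
  have \<A>: "\<A> \<in> carrier_mat (N * d) (N * d)"
    by (simp add: \<A>_def block_companion_carrier)
  have \<C>: "\<C> \<in> carrier_mat d (N * d)"
    using block_mat_carrier[of 1 N d d] by (simp add: \<C>_def)
  have T: "T \<in> carrier_mat (N * d) N"
    by (simp add: T_def observability_mat_carrier)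
  have "(A ^\<^sub>m N) $$ (i, j) + (\<Sum>x<N. a x * (A ^\<^sub>m x) $$ (i, j)) = 0" if "i < N" "j < N" for i j
    using cayley_hamilton_entry[OF A that] degree_monic_char_poly[OF A]
    by (simp add: lessThan_Suc_atMost[symmetric] a_def add.commute)
  then have TA: "T * A = \<A> * T"
    unfolding T_def \<A>_def by (intro observability_mat_intertwine[OF A C])
  have \<C>T: "\<C> * T = C"
    unfolding \<C>_def T_def by (rule first_block_observability_mat[OF \<open>N \<ge> 1\<close> A C])
  have TB: "T * B = block_mat N 1 d m (\<lambda>r c. \<beta> (r + 1))"
    unfolding T_def \<beta>_def by (simp add: observability_mat_mult[OF A C B])
  have "mcarma_form d m N \<A> (T * B) \<C>"
    unfolding \<A>_def TB \<C>_def using \<open>N \<ge> 1\<close>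
  proof (rule block_companion_mcarma_form)
    show "\<beta> k \<in> carrier_mat d m" for k
      unfolding \<beta>_def by (intro mult_carrier_mat[OF _ B] mult_carrier_mat[OF C] pow_carrier_mat[OF A])
  qed
  moreover have "output_process M L (N * d) m d \<A> (T * B) \<C> Y"
  proof -
    from \<open>output_process M L N m d A B C Y\<close> obtain X where
      X: "state_process M L N m A B X" and Y: "\<And>t. Y t \<in> measurable M (vec_borel d)"
      and YX: "\<And>t. AE \<omega> in M. Y t \<omega> = C *\<^sub>v X t \<omega>"
      unfolding output_process_def by blast
    have X_meas: "X t \<in> measurable M (vec_borel N)" for t
      using X by (simp add: state_process_def strictly_stationary_def)
    have L: "L t \<in> measurable M (vec_borel m)" for t
      using \<open>two_sided_levy M m L\<close> by (simp add: two_sided_levy_def)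
    have YTX: "AE \<omega> in M. Y t \<omega> = \<C> *\<^sub>v (T *\<^sub>v X t \<omega>)" for t
      using YX[of t] AE_space
    proof eventually_elim
      case (elim \<omega>)
      then show ?case
        using assoc_mult_mat_vec[OF \<C> T measurable_vec_borel_carrier[OF X_meas]] by (simp add: \<C>T)
    qed
    have "stable_mat \<A>"
      unfolding \<A>_def a_def using A \<open>N \<ge> 1\<close> \<open>stable_mat A\<close> by (rule stable_block_companion)
    then show ?thesis
      unfolding output_process_def
      by (intro conjI exI[of _ "\<lambda>t \<omega>. T *\<^sub>v X t \<omega>"] allI \<A> \<C> Y YTX
          mult_carrier_mat[OF T B] state_process_mult[OF X A B \<A> T TA L])
  qed
  ultimately show ?thesis
    using \<open>N \<ge> 1\<close> \<A> \<C> mult_carrier_mat[OF T B] by blast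
qed

end
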